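(* Let $N$ be a positive integer, let $A^{(i)}\in\mathbb{R}^{I_i\times I_i}$ for $i=1,2,\ldots,N$, and let $\mathcal{F}=A^{(N)}\otimes\cdots\otimes A^{(1)}$. Put $$M_S=\max_{i=1,2,\ldots,N}\|\mathcal{S}(A^{(i)})\|_2,\qquad M_H=\max_{i=1,2,\ldots,N}\rho(\mathcal{H}(A^{(i)})).$$ Then every eigenvalue $\lambda\in\sigma(\mathcal{H}(\mathcal{F}))$ satisfies $$|\lambda|\le\sum_{\substack{0\le r\le N\\ r\ \text{even}}}\frac{N!}{r!\,(N-r)!}\,M_S^{\,r}M_H^{\,N-r}\le(M_S+M_H)^N.$$
   Context: For a real square matrix $A$, $\mathcal{H}(A)=\frac12(A+A^T)$ and $\mathcal{S}(A)=\frac12(A-A^T)$ are its symmetric and skew-symmetric parts. $\sigma(W)$ is the set of all eigenvalues of $W$, $\rho(W)$ its spectral radius, $\|\cdot\|_2$ the matrix $2$-norm, and $\otimes$ the Kronecker product. In powers, $0^0=1$. *)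

theory Defs
  imports "Jordan_Normal_Form.Spectral_Radius" "HOL-Analysis.L2_Norm"
begin

definition sym_part :: "real mat \<Rightarrow> real mat" where
  "sym_part A = (1 / 2) \<cdot>\<^sub>m (A + transpose_mat A)"

definition skew_part :: "real mat \<Rightarrow> real mat" where
  "skew_part A = (1 / 2) \<cdot>\<^sub>m (A - transpose_mat A)"

definition vec_norm2 :: "real vec \<Rightarrow> real" where
  "vec_norm2 x = L2_set (\<lambda>i. x $ i) {..<dim_vec x}"

(* The operator norm induced by the Euclidean norms.  For a matrix without columns the set below
   is empty and the value is unspecified. *)
definition mat_norm2 :: "real mat \<Rightarrow> real" where
  "mat_norm2 A = Sup {vec_norm2 (A *\<^sub>v x) | x. x \<in> carrier_vec (dim_col A) \<and> vec_norm2 x = 1}"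

definition kron :: "'a::times mat \<Rightarrow> 'a mat \<Rightarrow> 'a mat" where
  "kron A B = mat (dim_row A * dim_row B) (dim_col A * dim_col B)
     (\<lambda>(i, j). A $$ (i div dim_row B, j div dim_col B) * B $$ (i mod dim_row B, j mod dim_col B))"

(* kron_upto A N is the Kronecker product of A N, ..., A 1, in this order (A N leftmost);
   the entry A 0 is not used. The empty product is the 1 x 1 identity matrix, which is neutral. *)
primrec kron_upto :: "(nat \<Rightarrow> 'a::semiring_1 mat) \<Rightarrow> nat \<Rightarrow> 'a mat" where
  "kron_upto A 0 = 1\<^sub>m 1"
| "kron_upto A (Suc n) = kron (A (Suc n)) (kron_upto A n)"

lemma kron_upto_one: "kron_upto A 1 = A 1"
  by (intro eq_matI) (simp_all add: kron_def)

(* The library's spectrum only contains eigenvalues in the entry type, so the (complex)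
   eigenvalues of a real matrix are those of its complexification. *)
abbreviation complex_mat :: "real mat \<Rightarrow> complex mat" where
  "complex_mat A \<equiv> map_mat complex_of_real A"

end

theory Submission
  imports Defs
begin

text \<open>Write \<open>H\<close> and \<open>S\<close> for symmetric and skew parts.  Then
  \<open>H(A \<otimes> B) = H(A) \<otimes> H(B) + S(A) \<otimes> S(B)\<close> and \<open>S(A \<otimes> B) = H(A) \<otimes> S(B) + S(A) \<otimes> H(B)\<close>.
  The operator norm is subadditive and submultiplicative under \<open>\<otimes>\<close>, so by induction on \<open>N\<close> the norms of
  \<open>H(F)\<close> and \<open>S(F)\<close> are at most \<open>((M_H + M_S)^N \<plusminus> (M_H - M_S)^N) / 2\<close>, and for the sign \<open>+\<close> this is the sum
  of the binomial terms of even index.  That the norm of a symmetric matrix is at most its spectral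
  radius is shown without diagonalization: \<open>k \<mapsto> \<parallel>H^k x\<parallel>\<close> is a convex sequence, which is bounded
  when the spectral radius is less than 1, hence nonincreasing.\<close>

section \<open>The Euclidean norm and bounds for matrices\<close>

lemma vec_norm2_nonneg [simp]: "0 \<le> vec_norm2 x"
  by (simp add: vec_norm2_def)

lemma vec_norm2_square: "(vec_norm2 x)\<^sup>2 = (\<Sum>i<dim_vec x. (x $ i)\<^sup>2)"
  by (simp add: vec_norm2_def L2_set_def sum_nonneg)

lemma vec_norm2_square_scalar_prod: "(vec_norm2 x)\<^sup>2 = x \<bullet> x"
  unfolding vec_norm2_square by (simp add: scalar_prod_def power2_eq_square lessThan_atLeast0)

lemma vec_norm2_smult: "vec_norm2 (c \<cdot>\<^sub>v x) = \<bar>c\<bar> * vec_norm2 x"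
proof -
  have "vec_norm2 (c \<cdot>\<^sub>v x) = L2_set (\<lambda>i. c * x $ i) {..<dim_vec x}"
    unfolding vec_norm2_def by (intro L2_set_cong) auto
  also have "\<dots> = \<bar>c\<bar> * vec_norm2 x"
    unfolding vec_norm2_def L2_set_def
    by (simp add: power_mult_distrib real_sqrt_mult flip: sum_distrib_left)
  finally show ?thesis .
qed

lemma vec_norm2_triangle:
  assumes "dim_vec x = dim_vec y"
  shows "vec_norm2 (x + y) \<le> vec_norm2 x + vec_norm2 y"
proof -
  have "vec_norm2 (x + y) = L2_set (\<lambda>i. x $ i + y $ i) {..<dim_vec y}"
    unfolding vec_norm2_def by (intro L2_set_cong) auto
  also have "\<dots> \<le> vec_norm2 x + vec_norm2 y"
    unfolding vec_norm2_def assms by (rule L2_set_triangle_ineq)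
  finally show ?thesis .
qed

lemma scalar_prod_le_vec_norm2:
  assumes "dim_vec x = dim_vec y"
  shows "x \<bullet> y \<le> vec_norm2 x * vec_norm2 y"
proof -
  have "x \<bullet> y \<le> (\<Sum>i<dim_vec y. \<bar>x $ i\<bar> * \<bar>y $ i\<bar>)"
    unfolding scalar_prod_def lessThan_atLeast0 by (intro sum_mono) (simp flip: abs_mult)
  also have "\<dots> \<le> vec_norm2 x * vec_norm2 y"
    unfolding vec_norm2_def assms by (rule L2_set_mult_ineq)
  finally show ?thesis .
qed

lemma abs_index_le_vec_norm2:
  assumes "i < dim_vec x"
  shows "\<bar>x $ i\<bar> \<le> vec_norm2 x"
proof -
  have "\<bar>x $ i\<bar> \<le> L2_set (\<lambda>i. \<bar>x $ i\<bar>) {..<dim_vec x}"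
    using assms by (intro member_le_L2_set) auto
  then show ?thesis
    by (simp add: vec_norm2_def L2_set_def)
qed

lemma mult_mat_vec_index_sum:
  assumes "i < dim_row A" "dim_vec x = dim_col A"
  shows "(A *\<^sub>v x) $ i = (\<Sum>j<dim_col A. A $$ (i, j) * x $ j)"
  using assms by (simp add: scalar_prod_def lessThan_atLeast0)

text \<open>A crude estimate through the sum of the absolute values of the entries; only finiteness
  matters. It bounds the supremum in \<open>mat_norm2\<close> and the orbit of a vector under matrix
  powers.\<close>

lemma vec_norm2_mult_le_norm_bound:
  assumes A: "norm_bound A c" and x: "x \<in> carrier_vec (dim_col A)"
  shows "vec_norm2 (A *\<^sub>v x) \<le> real (dim_row A) * (real (dim_col A) * (c * vec_norm2 x))"
proof -
  have "vec_norm2 (A *\<^sub>v x) \<le> (\<Sum>i<dim_row A. \<bar>(A *\<^sub>v x) $ i\<bar>)"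
    using L2_set_le_sum_abs[of "\<lambda>i. (A *\<^sub>v x) $ i" "{..<dim_row A}"]
    by (simp only: vec_norm2_def dim_mult_mat_vec)
  also have "\<dots> \<le> (\<Sum>i<dim_row A. real (dim_col A) * (c * vec_norm2 x))"
  proof (rule sum_mono)
    fix i assume i: "i \<in> {..<dim_row A}"
    then have "\<bar>(A *\<^sub>v x) $ i\<bar> = \<bar>\<Sum>j<dim_col A. A $$ (i, j) * x $ j\<bar>"
      using x by (subst mult_mat_vec_index_sum) auto
    also have "\<dots> \<le> (\<Sum>j<dim_col A. \<bar>A $$ (i, j)\<bar> * \<bar>x $ j\<bar>)"
      by (rule order_trans[OF sum_abs]) (simp add: abs_mult)
    also have "\<dots> \<le> (\<Sum>j<dim_col A. c * vec_norm2 x)"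
    proof (rule sum_mono)
      fix j assume j: "j \<in> {..<dim_col A}"
      have "\<bar>A $$ (i, j)\<bar> \<le> c"
        using A i j by (auto simp: norm_bound_def)
      then show "\<bar>A $$ (i, j)\<bar> * \<bar>x $ j\<bar> \<le> c * vec_norm2 x"
        using abs_index_le_vec_norm2[of j x] j x by (intro mult_mono) auto
    qed
    finally show "\<bar>(A *\<^sub>v x) $ i\<bar> \<le> real (dim_col A) * (c * vec_norm2 x)"
      by simp
  qed
  finally show ?thesis by simp
qed

text \<open>An upper bound for the operator norm that avoids the supremum. The conjunct
  \<open>0 \<le> c\<close> lets bounds be squared and multiplied, also for a matrix without columns,
  where the inequality alone would hold for every \<open>c\<close>.\<close>

definition l2_bounded :: "real mat \<Rightarrow> real \<Rightarrow> bool" where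
  "l2_bounded A c \<longleftrightarrow>
    0 \<le> c \<and> (\<forall>x \<in> carrier_vec (dim_col A). vec_norm2 (A *\<^sub>v x) \<le> c * vec_norm2 x)"

lemma l2_bounded_nonneg: "l2_bounded A c \<Longrightarrow> 0 \<le> c"
  by (simp add: l2_bounded_def)

lemma l2_bounded_mono:
  assumes "l2_bounded A c" "c \<le> d"
  shows "l2_bounded A d"
  using assms unfolding l2_bounded_def
  by (meson mult_right_mono order_trans vec_norm2_nonneg)

lemma l2_bounded_add:
  assumes A: "A \<in> carrier_mat m n" "l2_bounded A a"
    and B: "B \<in> carrier_mat m n" "l2_bounded B b"
  shows "l2_bounded (A + B) (a + b)"
proof -
  have "vec_norm2 ((A + B) *\<^sub>v x) \<le> (a + b) * vec_norm2 x" if x: "x \<in> carrier_vec n" for x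
  proof -
    have "vec_norm2 ((A + B) *\<^sub>v x) \<le> vec_norm2 (A *\<^sub>v x) + vec_norm2 (B *\<^sub>v x)"
      using A B x by (simp add: add_mult_distrib_mat_vec vec_norm2_triangle)
    moreover have "vec_norm2 (A *\<^sub>v x) \<le> a * vec_norm2 x" "vec_norm2 (B *\<^sub>v x) \<le> b * vec_norm2 x"
      using A B x by (auto simp: l2_bounded_def)
    ultimately show ?thesis by (simp add: distrib_right)
  qed
  then show ?thesis using A B by (simp add: l2_bounded_def)
qed

text \<open>Squaring removes the roots, and arbitrary functions \<open>f\<close> replace vectors.
  This form suits sums that are split into real and imaginary parts or into blocks.\<close>

lemma l2_bounded_iff_sum:
  "l2_bounded A c \<longleftrightarrow> 0 \<le> c \<and> (\<forall>f. (\<Sum>i<dim_row A. (\<Sum>j<dim_col A. A $$ (i, j) * f j)\<^sup>2)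
      \<le> c\<^sup>2 * (\<Sum>j<dim_col A. (f j)\<^sup>2))"
proof -
  have sq: "vec_norm2 (A *\<^sub>v x) \<le> c * vec_norm2 x \<longleftrightarrow>
      (\<Sum>i<dim_row A. (\<Sum>j<dim_col A. A $$ (i, j) * x $ j)\<^sup>2) \<le> c\<^sup>2 * (\<Sum>j<dim_col A. (x $ j)\<^sup>2)"
    if "0 \<le> c" "x \<in> carrier_vec (dim_col A)" for x
  proof -
    have "vec_norm2 (A *\<^sub>v x) \<le> c * vec_norm2 x \<longleftrightarrow>
        (vec_norm2 (A *\<^sub>v x))\<^sup>2 \<le> (c * vec_norm2 x)\<^sup>2"
      using that by (simp add: power_mono_iff)
    moreover have "(vec_norm2 (A *\<^sub>v x))\<^sup>2 =
        (\<Sum>i<dim_row A. (\<Sum>j<dim_col A. A $$ (i, j) * x $ j)\<^sup>2)"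
      unfolding vec_norm2_square using that
      by (intro sum.cong) (auto simp: mult_mat_vec_index_sum simp del: index_mult_mat_vec)
    ultimately show ?thesis
      using that by (simp add: power_mult_distrib vec_norm2_square)
  qed
  show ?thesis
  proof (intro iffI conjI allI)
    assume A: "l2_bounded A c"
    then show c: "0 \<le> c" by (rule l2_bounded_nonneg)
    fix f
    have "vec_norm2 (A *\<^sub>v vec (dim_col A) f) \<le> c * vec_norm2 (vec (dim_col A) f)"
      using A by (simp add: l2_bounded_def)
    then show "(\<Sum>i<dim_row A. (\<Sum>j<dim_col A. A $$ (i, j) * f j)\<^sup>2)
        \<le> c\<^sup>2 * (\<Sum>j<dim_col A. (f j)\<^sup>2)"
      by (subst (asm) sq[OF c]) auto
  next
    assume "0 \<le> c \<and> (\<forall>f. (\<Sum>i<dim_row A. (\<Sum>j<dim_col A. A $$ (i, j) * f j)\<^sup>2)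
        \<le> c\<^sup>2 * (\<Sum>j<dim_col A. (f j)\<^sup>2))"
    then show "l2_bounded A c"
      unfolding l2_bounded_def using sq by blast
  qed
qed

lemma l2_bounded_mat_norm2:
  assumes "0 < dim_col A"
  shows "l2_bounded A (mat_norm2 A)"
proof -
  let ?U = "{vec_norm2 (A *\<^sub>v x) | x. x \<in> carrier_vec (dim_col A) \<and> vec_norm2 x = 1}"
  obtain c where c: "norm_bound A c" using norm_bound_max by blast
  have bdd: "bdd_above ?U"
    using vec_norm2_mult_le_norm_bound[OF c]
    by (intro bdd_aboveI[where M = "real (dim_row A) * (real (dim_col A) * c)"]) fastforce
  have unit: "vec_norm2 (A *\<^sub>v x) \<le> mat_norm2 A"
    if "x \<in> carrier_vec (dim_col A)" "vec_norm2 x = 1" for x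
    unfolding mat_norm2_def using that by (intro cSup_upper bdd) auto
  \<comment> \<open>A column exists, hence a unit vector; the norm of its image shows that the
    supremum is nonnegative.\<close>
  let ?e = "unit_vec (dim_col A) 0 :: real vec"
  have "(vec_norm2 ?e)\<^sup>2 = 1"
    using assms by (simp add: vec_norm2_square_scalar_prod)
  then have "vec_norm2 ?e = 1"
    by (simp add: power2_eq_1_iff order.antisym)
       (metis vec_norm2_nonneg neg_0_le_iff_le not_one_le_zero)
  then have nonneg: "0 \<le> mat_norm2 A"
    using unit[of ?e] by (meson order_trans unit_vec_carrier vec_norm2_nonneg)
  have "vec_norm2 (A *\<^sub>v x) \<le> mat_norm2 A * vec_norm2 x" if x: "x \<in> carrier_vec (dim_col A)" for x
  proof (cases "vec_norm2 x = 0")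
    \<comment> \<open>A vector of norm 0 cannot be normalized; here the crude bound already gives
      0.\<close>
    case True
    then show ?thesis
      using vec_norm2_mult_le_norm_bound[OF c x] by simp
  next
    case False
    then have pos: "0 < vec_norm2 x" using vec_norm2_nonneg[of x] by linarith
    have A: "A \<in> carrier_mat (dim_row A) (dim_col A)" by simp
    have "vec_norm2 (A *\<^sub>v ((1 / vec_norm2 x) \<cdot>\<^sub>v x)) \<le> mat_norm2 A"
      using x pos by (intro unit) (auto simp: vec_norm2_smult)
    then show ?thesis
      using pos by (simp add: mult_mat_vec[OF A x] vec_norm2_smult field_simps)
  qed
  then show ?thesis using nonneg by (simp add: l2_bounded_def)
qed

text \<open>An eigenvector may be complex, whereas \<open>l2_bounded\<close> tests real vectors. A
  real matrix acts separately on real and imaginary parts, and the squared norms of these add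
  up.\<close>

lemma norm_eigenvalue_le_l2_bounded:
  assumes A: "A \<in> carrier_mat n n" and bound: "l2_bounded A c"
    and lam: "lam \<in> spectrum (complex_mat A)"
  shows "cmod lam \<le> c"
proof -
  obtain v where v: "v \<in> carrier_vec n" "v \<noteq> 0\<^sub>v n" "complex_mat A *\<^sub>v v = lam \<cdot>\<^sub>v v"
    using lam A by (auto simp: spectrum_def eigenvalue_def eigenvector_def)
  let ?V = "\<Sum>j<n. (cmod (v $ j))\<^sup>2"
  have dims: "dim_row A = n" "dim_col A = n" using A by auto
  have "(cmod lam)\<^sup>2 * ?V = (\<Sum>i<n. (cmod (lam * v $ i))\<^sup>2)"
    by (simp add: norm_mult power_mult_distrib sum_distrib_left)
  also have "\<dots> = (\<Sum>i<n. (\<Sum>j<n. A $$ (i, j) * Re (v $ j))\<^sup>2)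
      + (\<Sum>i<n. (\<Sum>j<n. A $$ (i, j) * Im (v $ j))\<^sup>2)"
  proof -
    have "lam * v $ i = (\<Sum>j<n. of_real (A $$ (i, j)) * v $ j)" if "i < n" for i
    proof -
      have "lam * v $ i = (complex_mat A *\<^sub>v v) $ i"
        unfolding v(3) using v(1) that by simp
      also have "\<dots> = (\<Sum>j<n. of_real (A $$ (i, j)) * v $ j)"
        using v(1) A that by (subst mult_mat_vec_index_sum) auto
      finally show ?thesis .
    qed
    then show ?thesis by (simp add: cmod_power2 sum.distrib)
  qed
  also have "\<dots> \<le> c\<^sup>2 * (\<Sum>j<n. (Re (v $ j))\<^sup>2) + c\<^sup>2 * (\<Sum>j<n. (Im (v $ j))\<^sup>2)"
    using bound unfolding l2_bounded_iff_sum dims by (intro add_mono) auto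
  also have "\<dots> = c\<^sup>2 * ?V"
    by (simp add: cmod_power2 sum.distrib distrib_left)
  finally have le: "(cmod lam)\<^sup>2 * ?V \<le> c\<^sup>2 * ?V" .
  \<comment> \<open>A nonzero entry makes \<open>?V\<close> positive, so it can be
    cancelled.\<close>
  obtain i where "i < n" "v $ i \<noteq> 0"
    using v(1,2) by (metis carrier_vecD eq_vecI index_zero_vec)
  then have "0 < ?V"
    by (intro sum_pos2[of _ i]) auto
  then have "(cmod lam)\<^sup>2 \<le> c\<^sup>2" using le by simp
  then show ?thesis
    using l2_bounded_nonneg[OF bound] by (rule power2_le_imp_le)
qed

section \<open>Norm and spectral radius of symmetric matrices\<close>

text \<open>Convexity makes the increments nondecreasing, so a positive first increment would force
  at least linear growth.\<close>

lemma convex_bounded_seq_le: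
  fixes a :: "nat \<Rightarrow> real"
  assumes convex: "\<And>k. 2 * a (Suc k) \<le> a k + a (Suc (Suc k))" and bounded: "\<And>k. a k \<le> C"
  shows "a 1 \<le> a 0"
proof (rule ccontr)
  assume "\<not> a 1 \<le> a 0"
  then have pos: "0 < a 1 - a 0" by simp
  have step: "a 1 - a 0 \<le> a (Suc k) - a k" for k
  proof (induction k)
    case (Suc k)
    then show ?case using convex[of k] by simp
  qed simp
  have "a 0 + real k * (a 1 - a 0) \<le> a k" for k
  proof (induction k)
    case (Suc k)
    then show ?case using step[of k] by (simp add: algebra_simps)
  qed simp
  moreover obtain k where "C - a 0 < real k * (a 1 - a 0)"
    using reals_Archimedean3[OF pos] by blast
  ultimately show False using bounded[of k] by (smt (verit))
qed

text \<open>By symmetry and Cauchy-Schwarz, |Ay|^2 = y . A^2 y \<le> |y| |A^2 y|, and the inequality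
  of means makes the norms along the orbit of \<open>x\<close> convex. A spectral radius below 1
  keeps the powers, hence the orbit, bounded.\<close>

lemma symmetric_contraction:
  assumes A: "A \<in> carrier_mat n n" and sym: "transpose_mat A = A"
    and rad: "spectral_radius (complex_mat A) < 1" and x: "x \<in> carrier_vec n"
  shows "vec_norm2 (A *\<^sub>v x) \<le> vec_norm2 x"
proof -
  define a where "a k = vec_norm2 (((\<lambda>v. A *\<^sub>v v) ^^ k) x)" for k
  have carrier: "((\<lambda>v. A *\<^sub>v v) ^^ k) x \<in> carrier_vec n" for k
    using A x by (induction k) auto
  have "2 * vec_norm2 (A *\<^sub>v y) \<le> vec_norm2 y + vec_norm2 (A *\<^sub>v (A *\<^sub>v y))"
    if y: "y \<in> carrier_vec n" for y
  proof -
    have "(vec_norm2 (A *\<^sub>v y))\<^sup>2 = y \<bullet> (A *\<^sub>v (A *\<^sub>v y))"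
      using transpose_vec_mult_scalar[OF A _ y, of "A *\<^sub>v y"] A y sym
        comm_scalar_prod[of "A *\<^sub>v (A *\<^sub>v y)" n y]
      by (simp add: vec_norm2_square_scalar_prod)
    also have "\<dots> \<le> vec_norm2 y * vec_norm2 (A *\<^sub>v (A *\<^sub>v y))"
      using A y by (intro scalar_prod_le_vec_norm2) auto
    \<comment> \<open>This is (p - q)^2 \<ge> 0 in the form 4pq \<le> (p + q)^2.\<close>
    finally have "(2 * vec_norm2 (A *\<^sub>v y))\<^sup>2 \<le> (vec_norm2 y + vec_norm2 (A *\<^sub>v (A *\<^sub>v y)))\<^sup>2"
      using zero_le_power2[of "vec_norm2 y - vec_norm2 (A *\<^sub>v (A *\<^sub>v y))"]
      by (simp add: power2_eq_square algebra_simps)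
    then show ?thesis
      by (rule power2_le_imp_le) simp
  qed
  then have convex: "2 * a (Suc k) \<le> a k + a (Suc (Suc k))" for k
    unfolding a_def using carrier by simp
  have cA: "complex_mat A \<in> carrier_mat n n" using A by simp
  obtain c where "norm_bound (complex_mat A ^\<^sub>m k) c" for k
    using spectral_radius_jnf_norm_bound_less_1_upper_triangular[OF cA rad] by blast
  \<comment> \<open>The bound on powers concerns the complexification; the embedding commutes with
    powers and preserves absolute values of entries.\<close>
  then have c: "norm_bound (A ^\<^sub>m k) c" for k
    using pow_carrier_mat[OF A, of k] of_real_hom.mat_hom_pow[OF A, of k]
    unfolding norm_bound_def by (metis carrier_matD index_map_mat norm_of_real real_norm_def)
  \<comment> \<open>Convexity speaks of iterates, boundedness of matrix powers. Matrix powers grow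
    by a factor on the right, hence \<open>funpow_Suc_right\<close> and the generalization over
    \<open>y\<close>.\<close>
  have pow: "((\<lambda>v. A *\<^sub>v v) ^^ k) y = A ^\<^sub>m k *\<^sub>v y" if "y \<in> carrier_vec n" for k y
    using that
  proof (induction k arbitrary: y)
    case (Suc k)
    have "A *\<^sub>v y \<in> carrier_vec n" using A Suc.prems by simp
    then show ?case
      using Suc assoc_mult_mat_vec[OF pow_carrier_mat[OF A] A]
      by (simp add: funpow_Suc_right del: funpow.simps(2))
  qed (use A in auto)
  have "a k \<le> real n * (real n * (c * vec_norm2 x))" for k
    unfolding a_def pow[OF x]
    using vec_norm2_mult_le_norm_bound[OF c, of x k] A x pow_mat_dim_square[OF A, of k] by simp
  with convex have "a 1 \<le> a 0" by (rule convex_bounded_seq_le)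
  then show ?thesis by (simp add: a_def)
qed

lemma eigenvalue_smult:
  fixes A :: "'a :: field mat"
  assumes A: "A \<in> carrier_mat n n" and e: "eigenvalue (c \<cdot>\<^sub>m A) e" and c: "c \<noteq> 0"
  shows "eigenvalue A (e / c)"
proof -
  obtain v where v: "v \<in> carrier_vec n" "v \<noteq> 0\<^sub>v n" "(c \<cdot>\<^sub>m A) *\<^sub>v v = e \<cdot>\<^sub>v v"
    using e A by (auto simp: eigenvalue_def eigenvector_def)
  have "A *\<^sub>v v = (e / c) \<cdot>\<^sub>v v"
  proof (rule eq_vecI)
    fix i assume i: "i < dim_vec ((e / c) \<cdot>\<^sub>v v)"
    then have "c * (A *\<^sub>v v) $ i = ((c \<cdot>\<^sub>m A) *\<^sub>v v) $ i"
      using A v(1) by simp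
    also have "\<dots> = e * v $ i" unfolding v(3) using i v(1) by simp
    finally show "(A *\<^sub>v v) $ i = ((e / c) \<cdot>\<^sub>v v) $ i"
      using i c by (simp add: field_simps)
  qed (use A v in auto)
  then show ?thesis
    using v A by (auto simp: eigenvalue_def eigenvector_def)
qed

text \<open>Dividing by any \<open>t\<close> above the spectral radius brings the radius below 1, so
  the contraction lemma applies; then \<open>t\<close> decreases to the radius. Passing through
  \<open>t\<close> also covers radius 0. The condition \<open>0 < n\<close> makes the spectrum
  nonempty.\<close>

lemma symmetric_l2_bounded_spectral_radius:
  assumes A: "A \<in> carrier_mat n n" and n: "0 < n" and sym: "transpose_mat A = A"
  shows "l2_bounded A (spectral_radius (complex_mat A))"
proof -
  let ?r = "spectral_radius (complex_mat A)"
  have cA: "complex_mat A \<in> carrier_mat n n" using A by simp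
  have r: "0 \<le> ?r" using spectral_radius_mem_max(1)[OF cA n] by auto
  have "vec_norm2 (A *\<^sub>v x) \<le> t * vec_norm2 x" if t: "?r < t" and x: "x \<in> carrier_vec n" for t x
  proof -
    have t0: "0 < t" using r t by linarith
    let ?B = "(1 / t) \<cdot>\<^sub>m A"
    have cB: "complex_mat ?B = complex_of_real (1 / t) \<cdot>\<^sub>m complex_mat A"
      by (intro eq_matI) auto
    have "complex_mat ?B \<in> carrier_mat n n" using A by simp
    \<comment> \<open>The radius of \<open>?B\<close> is attained at some \<open>e\<close>; then
      \<open>e\<close> times \<open>t\<close> is an eigenvalue of \<open>A\<close>, so its modulus
      is at most \<open>?r\<close>, which is below \<open>t\<close>.\<close>
    from spectral_radius_mem_max(1)[OF this n]
    obtain e where e: "eigenvalue (complex_mat ?B) e" "spectral_radius (complex_mat ?B) = cmod e"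
      by (auto simp: spectrum_def)
    have "eigenvalue (complex_mat A) (e / complex_of_real (1 / t))"
      using e(1) t0 unfolding cB by (intro eigenvalue_smult[OF cA]) auto
    then have "cmod (e / complex_of_real (1 / t)) \<le> ?r"
      by (intro spectral_radius_mem_max(2)[OF cA n]) (auto simp: spectrum_def)
    then have "cmod e * t \<le> ?r"
      using t0 by (simp add: norm_mult norm_divide)
    then have "cmod e * t < 1 * t"
      using t by linarith
    then have "spectral_radius (complex_mat ?B) < 1"
      using t0 unfolding e(2) by (rule mult_right_less_imp_less[OF _ less_imp_le])
    moreover have "transpose_mat ?B = (1 / t) \<cdot>\<^sub>m transpose_mat A"
      by (intro eq_matI) auto
    then have "transpose_mat ?B = ?B" by (simp add: sym)
    ultimately have "vec_norm2 (?B *\<^sub>v x) \<le> vec_norm2 x"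
      using A x by (intro symmetric_contraction) auto
    moreover have "?B *\<^sub>v x = (1 / t) \<cdot>\<^sub>v (A *\<^sub>v x)"
      using A x by (intro eq_vecI) auto
    ultimately show ?thesis
      using t0 by (simp add: vec_norm2_smult field_simps)
  qed
  note le = this
  have "vec_norm2 (A *\<^sub>v x) \<le> ?r * vec_norm2 x" if x: "x \<in> carrier_vec n" for x
  proof (rule tendsto_lowerbound)
    show "((\<lambda>t. t * vec_norm2 x) \<longlongrightarrow> ?r * vec_norm2 x) (at_right ?r)"
      by (intro tendsto_intros)
    show "\<forall>\<^sub>F t in at_right ?r. vec_norm2 (A *\<^sub>v x) \<le> t * vec_norm2 x"
      using le x by (auto simp: eventually_at_filter)
  qed simp
  then show ?thesis using r A by (simp add: l2_bounded_def)
qed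

section \<open>Kronecker products\<close>

lemma sum_lessThan_mult:
  fixes f :: "nat \<Rightarrow> 'a :: comm_monoid_add"
  shows "(\<Sum>r<m * n. f r) = (\<Sum>i<m. \<Sum>k<n. f (i * n + k))"
proof -
  have "sum f {i * n..<i * n + n} = (\<Sum>k<n. f (i * n + k))" for i
    using sum.shift_bounds_nat_ivl[of f 0 "i * n" n] by (simp add: lessThan_atLeast0 add.commute)
  then show ?thesis by (simp flip: sum.nat_group)
qed

lemma dim_kron [simp]:
  "dim_row (kron A B) = dim_row A * dim_row B" "dim_col (kron A B) = dim_col A * dim_col B"
  by (simp_all add: kron_def)

lemma kron_carrier:
  assumes "A \<in> carrier_mat m n" "B \<in> carrier_mat p q"
  shows "kron A B \<in> carrier_mat (m * p) (n * q)"
  using assms by auto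

text \<open>The indices have the form produced by \<open>sum_lessThan_mult\<close> (block number and
  position inside the block), so \<open>div\<close> and \<open>mod\<close> disappear.\<close>

lemma kron_index:
  assumes "i < dim_row A" "k < dim_row B" "j < dim_col A" "l < dim_col B"
  shows "kron A B $$ (i * dim_row B + k, j * dim_col B + l) = A $$ (i, j) * B $$ (k, l)"
proof -
  have less: "i * p + k < m * p" if "i < m" "k < p" for i k m p :: nat
  proof -
    have "i * p + k < Suc i * p" using that by simp
    also have "\<dots> \<le> m * p" using that by (intro mult_le_mono1) simp
    finally show ?thesis .
  qed
  show ?thesis using assms by (simp add: kron_def less)
qed

text \<open>The product acts in two stages: \<open>B\<close> on each block of the vector, then
  \<open>A\<close> across the blocks at each fixed position. Each stage costs one factor.\<close>

lemma l2_bounded_kron: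
  assumes A: "l2_bounded A a" and B: "l2_bounded B b"
  shows "l2_bounded (kron A B) (a * b)"
proof -
  let ?m = "dim_row A" and ?n = "dim_col A" and ?p = "dim_row B" and ?q = "dim_col B"
  note a = A[unfolded l2_bounded_iff_sum] and b = B[unfolded l2_bounded_iff_sum]
  have "(\<Sum>r<?m * ?p. (\<Sum>s<?n * ?q. kron A B $$ (r, s) * f s)\<^sup>2)
      \<le> (a * b)\<^sup>2 * (\<Sum>s<?n * ?q. (f s)\<^sup>2)" for f
  proof -
    \<comment> \<open>Entry \<open>k\<close> of \<open>B\<close> applied to block \<open>j\<close>
      of \<open>f\<close>.\<close>
    define z where "z j k = (\<Sum>l<?q. B $$ (k, l) * f (j * ?q + l))" for j k
    have "(\<Sum>r<?m * ?p. (\<Sum>s<?n * ?q. kron A B $$ (r, s) * f s)\<^sup>2)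
        = (\<Sum>i<?m. \<Sum>k<?p. (\<Sum>j<?n. A $$ (i, j) * z j k)\<^sup>2)"
      unfolding sum_lessThan_mult z_def
      by (intro sum.cong refl arg_cong[where f = "\<lambda>t. t\<^sup>2"])
         (simp add: kron_index sum_distrib_left mult.assoc)
    \<comment> \<open>With \<open>k\<close> outermost, the bound for \<open>A\<close> applies to
      \<open>z j k\<close> as a vector in \<open>j\<close>; swapping back allows the bound for
      \<open>B\<close> in each block.\<close>
    also have "\<dots> = (\<Sum>k<?p. \<Sum>i<?m. (\<Sum>j<?n. A $$ (i, j) * z j k)\<^sup>2)"
      by (rule sum.swap)
    also have "\<dots> \<le> (\<Sum>k<?p. a\<^sup>2 * (\<Sum>j<?n. (z j k)\<^sup>2))"
      using a by (intro sum_mono) auto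
    also have "\<dots> = a\<^sup>2 * (\<Sum>j<?n. \<Sum>k<?p. (z j k)\<^sup>2)"
      by (subst sum.swap) (simp add: sum_distrib_left)
    also have "\<dots> \<le> a\<^sup>2 * (\<Sum>j<?n. b\<^sup>2 * (\<Sum>l<?q. (f (j * ?q + l))\<^sup>2))"
      unfolding z_def using b by (intro mult_left_mono sum_mono) auto
    also have "\<dots> = (a * b)\<^sup>2 * (\<Sum>s<?n * ?q. (f s)\<^sup>2)"
      by (simp add: sum_lessThan_mult power_mult_distrib sum_distrib_left mult.assoc)
    finally show ?thesis .
  qed
  then show ?thesis
    using a b by (simp add: l2_bounded_iff_sum)
qed

section \<open>Symmetric and skew-symmetric parts of Kronecker products\<close>

lemma sym_part_carrier [simp]: "A \<in> carrier_mat n n \<Longrightarrow> sym_part A \<in> carrier_mat n n"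
  by (simp add: sym_part_def)

lemma skew_part_carrier [simp]: "A \<in> carrier_mat n n \<Longrightarrow> skew_part A \<in> carrier_mat n n"
  by (simp add: skew_part_def minus_carrier_mat)

lemma transpose_sym_part:
  assumes "A \<in> carrier_mat n n"
  shows "transpose_mat (sym_part A) = sym_part A"
  using assms by (intro eq_matI) (auto simp: sym_part_def)

lemma div_less_of_less_mult: "(r :: nat) < m * p \<Longrightarrow> r div p < m \<and> r mod p < p"
  by (metis less_mult_imp_div_less mod_less_divisor mult_0_right not_gr_zero not_less_zero)

text \<open>Transposition acts on each factor and negates skew parts. Expanding both factors, the
  products with an even number of skew factors are therefore symmetric and the others skew.\<close>

lemma sym_part_kron:
  assumes "A \<in> carrier_mat m m" "B \<in> carrier_mat p p"
  shows "sym_part (kron A B) = kron (sym_part A) (sym_part B) + kron (skew_part A) (skew_part B)"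
  using assms
  by (intro eq_matI)
     (auto simp: sym_part_def skew_part_def kron_def div_less_of_less_mult field_simps)

lemma skew_part_kron:
  assumes "A \<in> carrier_mat m m" "B \<in> carrier_mat p p"
  shows "skew_part (kron A B) = kron (sym_part A) (skew_part B) + kron (skew_part A) (sym_part B)"
  using assms
  by (intro eq_matI)
     (auto simp: sym_part_def skew_part_def kron_def div_less_of_less_mult field_simps)

text \<open>Both parts are bounded together because each part of the next product involves both
  parts of the previous one.\<close>

lemma kron_upto_l2_bounded:
  assumes "\<And>i. i \<in> {1..N} \<Longrightarrow> A i \<in> carrier_mat (I i) (I i)"
    and "\<And>i. i \<in> {1..N} \<Longrightarrow> l2_bounded (sym_part (A i)) h"
    and "\<And>i. i \<in> {1..N} \<Longrightarrow> l2_bounded (skew_part (A i)) s"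
  shows "kron_upto A N \<in> carrier_mat (\<Prod>i\<in>{1..N}. I i) (\<Prod>i\<in>{1..N}. I i) \<and>
    l2_bounded (sym_part (kron_upto A N)) (((h + s) ^ N + (h - s) ^ N) / 2) \<and>
    l2_bounded (skew_part (kron_upto A N)) (((h + s) ^ N - (h - s) ^ N) / 2)"
  using assms
proof (induction N)
  case 0
  \<comment> \<open>For the empty product the bounds are 1 and 0, since zeroth powers are 1 even
    when \<open>h = s\<close>.\<close>
  have "sym_part (1\<^sub>m 1) = 1\<^sub>m 1" "skew_part (1\<^sub>m 1) = 0\<^sub>m 1 1"
    by (auto simp: sym_part_def skew_part_def intro!: eq_matI)
  then show ?case by (simp add: l2_bounded_iff_sum)
next
  case (Suc N)
  let ?d = "\<Prod>i\<in>{1..N}. I i"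
  let ?E = "((h + s) ^ N + (h - s) ^ N) / 2" and ?O = "((h + s) ^ N - (h - s) ^ N) / 2"
  let ?A = "A (Suc N)" and ?B = "kron_upto A N"
  have A: "?A \<in> carrier_mat (I (Suc N)) (I (Suc N))"
    and h: "l2_bounded (sym_part ?A) h" and s: "l2_bounded (skew_part ?A) s"
    using Suc.prems by auto
  have B: "?B \<in> carrier_mat ?d ?d" "l2_bounded (sym_part ?B) ?E" "l2_bounded (skew_part ?B) ?O"
    using Suc by auto
  have bounds: "l2_bounded (sym_part (kron ?A ?B)) (h * ?E + s * ?O)"
    "l2_bounded (skew_part (kron ?A ?B)) (h * ?O + s * ?E)"
    unfolding sym_part_kron[OF A B(1)] skew_part_kron[OF A B(1)]
    by (rule l2_bounded_add[OF kron_carrier l2_bounded_kron kron_carrier l2_bounded_kron];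
        fact A B h s sym_part_carrier[OF A] skew_part_carrier[OF A]
          sym_part_carrier[OF B(1)] skew_part_carrier[OF B(1)])+
  \<comment> \<open>The recursion decouples: sum and difference of the two bounds are multiplied by
    \<open>h + s\<close> and \<open>h - s\<close>.\<close>
  have eqs: "h * ?E + s * ?O = ((h + s) ^ Suc N + (h - s) ^ Suc N) / 2"
    "h * ?O + s * ?E = ((h + s) ^ Suc N - (h - s) ^ Suc N) / 2"
    by (simp_all add: field_simps)
  show ?case
    using kron_carrier[OF A B(1)] bounds[unfolded eqs] by (simp add: mult.commute)
qed

section \<open>The even binomial sum and the final estimate\<close>

lemma sum_even_binomial:
  fixes s h :: real
  shows "(\<Sum>r | r \<le> N \<and> even r. fact N / (fact r * fact (N - r)) * s ^ r * h ^ (N - r))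
    = ((h + s) ^ N + (h - s) ^ N) / 2"
proof -
  let ?t = "\<lambda>r. of_nat (N choose r) * s ^ r * h ^ (N - r)"
  have "(h + s) ^ N + (h - s) ^ N = (s + h) ^ N + (- s + h) ^ N"
    by (simp add: add.commute)
  also have "\<dots> = (\<Sum>r\<le>N. ?t r + of_nat (N choose r) * (- s) ^ r * h ^ (N - r))"
    unfolding binomial_ring by (simp add: sum.distrib)
  \<comment> \<open>Replacing \<open>s\<close> by \<open>- s\<close> cancels the odd terms and
    doubles the even ones.\<close>
  also have "\<dots> = (\<Sum>r\<le>N. if even r then 2 * ?t r else 0)"
    by (intro sum.cong) auto
  also have "\<dots> = 2 * (\<Sum>r | r \<le> N \<and> even r. ?t r)"
    by (simp add: sum_distrib_left sum.If_cases Collect_conj_eq atMost_def)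
  also have "(\<Sum>r | r \<le> N \<and> even r. ?t r)
      = (\<Sum>r | r \<le> N \<and> even r. fact N / (fact r * fact (N - r)) * s ^ r * h ^ (N - r))"
    by (intro sum.cong) (auto simp: binomial_fact)
  finally show ?thesis by simp
qed

theorem proposition2p6:
  fixes N :: nat and I :: "nat \<Rightarrow> nat" and A :: "nat \<Rightarrow> real mat" and M_S M_H :: real
  assumes "N \<ge> 1"
    and "\<And>i. i \<in> {1..N} \<Longrightarrow> I i \<ge> 1"
    and "\<And>i. i \<in> {1..N} \<Longrightarrow> A i \<in> carrier_mat (I i) (I i)"
    and "M_S = Max ((\<lambda>i. mat_norm2 (skew_part (A i))) ` {1..N})"
    and "M_H = Max ((\<lambda>i. spectral_radius (complex_mat (sym_part (A i)))) ` {1..N})"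
  shows "\<forall>lam \<in> spectrum (complex_mat (sym_part (kron_upto A N))).
    cmod lam \<le> (\<Sum>r | r \<le> N \<and> even r. fact N / (fact r * fact (N - r)) * M_S ^ r * M_H ^ (N - r)) \<and>
    (\<Sum>r | r \<le> N \<and> even r. fact N / (fact r * fact (N - r)) * M_S ^ r * M_H ^ (N - r))
      \<le> (M_S + M_H) ^ N"
proof
  fix lam assume lam: "lam \<in> spectrum (complex_mat (sym_part (kron_upto A N)))"
  have H: "l2_bounded (sym_part (A i)) M_H" and S: "l2_bounded (skew_part (A i)) M_S"
    if i: "i \<in> {1..N}" for i
  proof -
    have A: "A i \<in> carrier_mat (I i) (I i)" and "0 < I i"
      using assms(2,3)[OF i] by auto
    have "l2_bounded (sym_part (A i)) (spectral_radius (complex_mat (sym_part (A i))))"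
      using A \<open>0 < I i\<close> by (intro symmetric_l2_bounded_spectral_radius transpose_sym_part) auto
    moreover have "spectral_radius (complex_mat (sym_part (A i))) \<le> M_H"
      unfolding assms(5) using i by (intro Max_ge) auto
    ultimately show "l2_bounded (sym_part (A i)) M_H" by (rule l2_bounded_mono)
    have "l2_bounded (skew_part (A i)) (mat_norm2 (skew_part (A i)))"
      using skew_part_carrier[OF A] \<open>0 < I i\<close> by (intro l2_bounded_mat_norm2) auto
    moreover have "mat_norm2 (skew_part (A i)) \<le> M_S"
      unfolding assms(4) using i by (intro Max_ge) auto
    ultimately show "l2_bounded (skew_part (A i)) M_S" by (rule l2_bounded_mono)
  qed
  \<comment> \<open>Index 1 is available because \<open>N \<ge> 1\<close>.\<close>
  have nonneg: "0 \<le> M_H" "0 \<le> M_S"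
    using H[of 1] S[of 1] assms(1) by (auto dest: l2_bounded_nonneg)
  \<comment> \<open>\<open>M_H - M_S\<close> may be negative, so its power is compared through the
    absolute value; the mean of the two powers is then at most the larger one.\<close>
  have "\<bar>M_H - M_S\<bar> \<le> M_H + M_S" using nonneg by linarith
  then have "(M_H - M_S) ^ N \<le> (M_H + M_S) ^ N"
    by (metis abs_ge_self abs_ge_zero order_trans power_abs power_mono)
  moreover have "cmod lam \<le> ((M_H + M_S) ^ N + (M_H - M_S) ^ N) / 2"
    using kron_upto_l2_bounded[of N A I M_H M_S, OF assms(3) H S] lam
    by (blast intro: norm_eigenvalue_le_l2_bounded sym_part_carrier)
  ultimately show "cmod lam \<le>
      (\<Sum>r | r \<le> N \<and> even r. fact N / (fact r * fact (N - r)) * M_S ^ r * M_H ^ (N - r)) \<and>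
    (\<Sum>r | r \<le> N \<and> even r. fact N / (fact r * fact (N - r)) * M_S ^ r * M_H ^ (N - r))
      \<le> (M_S + M_H) ^ N"
    unfolding sum_even_binomial by (simp add: add.commute)
qed

end
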